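(* Let $f(t)=2t\left(t-\frac{1}{W\left(\frac{1}{t-1}\right)}\right)$ for $t>1$, where $W$ is the Lambert $W$-function (the inverse of $y\mapsto ye^y$ on $[0,\infty)$), and let $\alpha=\min_{t>1}f(t)\approx 0.9408008$. Then for all sufficiently large $n$, every graph $G$ with $n$ vertices and $k$ edges satisfies (a) $\beta(G)\le n-\frac{\alpha k}{n}$ and (b) $e(G)\ge \frac{\alpha}{n}$.
   Context: All graphs are finite and simple. For a graph $H$, let $c_i(H)$ be the number of cliques of size $i$ ($c_0(H)=1$) and $\omega(H)$ the clique number. $PC(H,x)=\sum_{i=0}^{\omega(H)}(-1)^i c_i(H)x^{\omega(H)-i}$, and $\beta(H)$ is its largest real root. For a graph $H$ with $n$ vertices and $k\ge1$ edges, the edge $PC$-density is $e(H)=\frac{n-\beta(H)}{k}$; for the empty graph on $n$ vertices one sets $e=\frac1n$. *)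

theory Defs
  imports Complex_Main "HOL-Library.Ramsey" "HOL-Computational_Algebra.Polynomial"
begin

definition simple_graph :: "'a set \<Rightarrow> 'a set set \<Rightarrow> bool" where
  "simple_graph V E \<longleftrightarrow> finite V \<and> E \<subseteq> [V]\<^bsup>2\<^esup>"

definition cliques :: "'a set \<Rightarrow> 'a set set \<Rightarrow> 'a set set" where
  "cliques V E = {K. K \<subseteq> V \<and> clique K E}"

definition clique_count :: "'a set \<Rightarrow> 'a set set \<Rightarrow> nat \<Rightarrow> nat" where
  "clique_count V E i = card {K \<in> cliques V E. card K = i}"

definition clique_number :: "'a set \<Rightarrow> 'a set set \<Rightarrow> nat" where
  "clique_number V E = Max (card ` cliques V E)"

definition PC :: "'a set \<Rightarrow> 'a set set \<Rightarrow> real poly" where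
  "PC V E = (\<Sum>i = 0..clique_number V E.
     monom ((-1) ^ i * real (clique_count V E i)) (clique_number V E - i))"

(* The set of real roots is finite, since PC V E is monic
   (its leading coefficient is clique_count V E 0 = 1). Max is arbitrary if there is no
   real root, as happens for the graph without vertices, where PC V E = 1. *)
definition PC_beta :: "'a set \<Rightarrow> 'a set set \<Rightarrow> real" where
  "PC_beta V E = Max {x. poly (PC V E) x = 0}"

definition edge_PC_density :: "'a set \<Rightarrow> 'a set set \<Rightarrow> real" where
  "edge_PC_density V E =
     (if E = {} then 1 / real (card V)
      else (real (card V) - PC_beta V E) / real (card E))"

(* Meaningful for arguments in {0..}, which y \<mapsto> y * exp y maps bijectively onto itself. *)
definition lambert_W :: "real \<Rightarrow> real" where
  "lambert_W = the_inv_into {0..} (\<lambda>y. y * exp y)"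

definition PC_f :: "real \<Rightarrow> real" where
  "PC_f t = 2 * t * (t - 1 / lambert_W (1 / (t - 1)))"

(* Least of an order is THE smallest element, so PC_alpha is the minimum of PC_f over t > 1
   (unspecified if the minimum were not attained). *)
definition PC_alpha :: real where
  "PC_alpha = (LEAST a. a \<in> PC_f ` {1<..})"

end

theory Submission
  imports Defs
begin

text \<open>
  With D_H(x) the alternating clique sum of the induced subgraph H, the reciprocal r of PC_beta is
  the least positive root of D_V, all D_H are nonnegative at r, and
  D_(H + v) = D_H - x D_(H \<inter> N(v)) \<ge> D_H - x (1 - x)^b, where b is the degree of v in H + v.
  Always removing a vertex of minimum degree gives b (b + 1) \<le> 2 k for the number k of edges, and
  concavity turns this into the bound D_V(x) \<ge> exp (- s x) - (n - s) x with s = sqrt (2 k), valid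
  for n x \<le> 2: asymptotically the worst graph is a clique on s vertices together with isolated
  vertices. At x = r the left-hand side vanishes; with w = s r the resulting inequality is governed
  by the minimum over w > 0 of PC_f at t = 1 + exp (- w) / w. If n r > 2, the bound is trivial, as
  2 k \<le> n^2.
\<close>

subsection \<open>Alternating clique sums\<close>

text \<open>Up to a power of x this is \<open>PC\<close> at 1 / x, freed of the clique number. Since
  \<open>E\<close> stays fixed while \<open>V\<close> varies, an induced subgraph is simply a subset
  of the vertex set.\<close>

definition clique_sum :: "'a set \<Rightarrow> 'a set set \<Rightarrow> real \<Rightarrow> real" where
  "clique_sum V E x = (\<Sum>K\<in>cliques V E. (- x) ^ card K)"

definition neighbours :: "'a set set \<Rightarrow> 'a \<Rightarrow> 'a set" where
  "neighbours E v = {w. {v, w} \<in> E}"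

lemma finite_cliques: "finite V \<Longrightarrow> finite (cliques V E)"
  by (rule finite_subset[of _ "Pow V"]) (auto simp: cliques_def)

lemma cliques_empty [simp]: "cliques {} E = {{}}"
  by (auto simp: cliques_def)

lemma clique_sum_empty [simp]: "clique_sum {} E x = 1"
  by (simp add: clique_sum_def)

lemma cliques_insert:
  assumes "v \<notin> V"
  shows "cliques (insert v V) E = cliques V E \<union> insert v ` cliques (V \<inter> neighbours E v) E"
proof (intro equalityI subsetI)
  fix K assume K: "K \<in> cliques (insert v V) E"
  show "K \<in> cliques V E \<union> insert v ` cliques (V \<inter> neighbours E v) E"
  proof (cases "v \<in> K")
    case True
    then have "K = insert v (K - {v})" by blast
    moreover have "K - {v} \<in> cliques (V \<inter> neighbours E v) E"
      using K True assms by (auto simp: cliques_def clique_def neighbours_def)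
    ultimately show ?thesis by blast
  next
    case False
    then show ?thesis using K by (auto simp: cliques_def)
  qed
next
  fix K assume "K \<in> cliques V E \<union> insert v ` cliques (V \<inter> neighbours E v) E"
  then show "K \<in> cliques (insert v V) E"
    by (auto simp: cliques_def clique_def neighbours_def insert_commute subset_iff)
qed

text \<open>A clique through \<open>v\<close> is \<open>v\<close> together with a clique among its
  neighbours, which brings one more factor - x. This recursion is behind every estimate of clique
  sums.\<close>

lemma clique_sum_insert:
  assumes "finite V" "v \<notin> V"
  shows "clique_sum (insert v V) E x = clique_sum V E x - x * clique_sum (V \<inter> neighbours E v) E x"
proof -
  let ?N = "V \<inter> neighbours E v"
  have inj: "inj_on (insert v) (cliques ?N E)"
    using assms(2) by (auto simp: inj_on_def cliques_def)
  have card: "card (insert v K) = Suc (card K)" if "K \<in> cliques ?N E" for K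
    using that assms by (auto simp: cliques_def intro!: card_insert_disjoint intro: finite_subset)
  have "clique_sum (insert v V) E x =
      (\<Sum>K\<in>cliques V E. (- x) ^ card K) + (\<Sum>K\<in>insert v ` cliques ?N E. (- x) ^ card K)"
    unfolding clique_sum_def cliques_insert[OF assms(2)]
    using assms by (intro sum.union_disjoint) (auto simp: finite_cliques cliques_def)
  also have "(\<Sum>K\<in>insert v ` cliques ?N E. (- x) ^ card K) = (\<Sum>K\<in>cliques ?N E. - x * (- x) ^ card K)"
    by (subst sum.reindex[OF inj]) (auto intro!: sum.cong simp: card)
  also have "\<dots> = - x * clique_sum ?N E x"
    by (simp add: clique_sum_def sum_distrib_left)
  finally show ?thesis by (simp add: clique_sum_def)
qed

text \<open>The missing vertices are added to \<open>H\<close> one at a time; by the recursion each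
  addition subtracts x times a clique sum of an induced subgraph, which is nonnegative by
  assumption.\<close>

lemma clique_sum_antimono:
  assumes "finite V" "0 \<le> x" and nonneg: "\<And>H. H \<subseteq> V \<Longrightarrow> 0 \<le> clique_sum H E x" and "H \<subseteq> V"
  shows "clique_sum V E x \<le> clique_sum H E x"
proof -
  have "clique_sum (H \<union> W) E x \<le> clique_sum H E x" if "finite W" "W \<subseteq> V" for W
    using that
  proof (induction W rule: finite_induct)
    case (insert v W)
    show ?case
    proof (cases "v \<in> H")
      case True
      then show ?thesis using insert by (simp add: insert_absorb)
    next
      case False
      have "(H \<union> W) \<inter> neighbours E v \<subseteq> V" using assms(4) insert.prems by blast
      then have "0 \<le> x * clique_sum ((H \<union> W) \<inter> neighbours E v) E x"
        using nonneg assms(2) by simp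
      moreover have "finite (H \<union> W)"
        using assms(1,4) insert.hyps finite_subset by blast
      ultimately show ?thesis
        using insert False by (simp add: clique_sum_insert)
    qed
  qed simp
  from this[of V] show ?thesis using assms by (simp add: Un_absorb1)
qed

text \<open>By antimonotonicity the neighbourhood of a new vertex has at least the clique sum of the
  old graph, so the recursion gains a factor of at most 1 - x per vertex. Complete graphs give
  equality.\<close>

lemma clique_sum_le_power:
  assumes "finite V" "0 \<le> x" "x \<le> 1" "\<And>H. H \<subseteq> V \<Longrightarrow> 0 \<le> clique_sum H E x"
  shows "clique_sum V E x \<le> (1 - x) ^ card V"
  using assms
proof (induction V rule: finite_induct)
  case (insert v V)
  have nonneg: "0 \<le> clique_sum H E x" if "H \<subseteq> V" for H
    using insert.prems(3) that by blast
  have "clique_sum V E x \<le> clique_sum (V \<inter> neighbours E v) E x"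
    by (rule clique_sum_antimono) (use insert nonneg in auto)
  then have "clique_sum (insert v V) E x \<le> (1 - x) * clique_sum V E x"
    using insert by (simp add: clique_sum_insert algebra_simps mult_left_mono)
  also have "\<dots> \<le> (1 - x) * (1 - x) ^ card V"
    using insert nonneg by (intro mult_left_mono) auto
  finally show ?case using insert.hyps by simp
qed simp

section \<open>Edges and degrees in induced subgraphs\<close>

lemma card_edges_insert:
  assumes "\<And>e. e \<in> E \<Longrightarrow> card e = 2" "finite V" "v \<notin> V"
  shows "card (E \<inter> Pow (insert v V)) = card (E \<inter> Pow V) + card (V \<inter> neighbours E v)"
proof -
  have "E \<inter> Pow (insert v V) = E \<inter> Pow V \<union> (\<lambda>w. {v, w}) ` (V \<inter> neighbours E v)"
  proof (intro equalityI subsetI)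
    fix e assume e: "e \<in> E \<inter> Pow (insert v V)"
    show "e \<in> E \<inter> Pow V \<union> (\<lambda>w. {v, w}) ` (V \<inter> neighbours E v)"
    proof (cases "v \<in> e")
      case True
      from e assms(1) have "card e = 2" by blast
      then obtain w where "e = {v, w}" "w \<noteq> v"
        using True by (auto simp: card_2_iff)
      then show ?thesis using e by (auto simp: neighbours_def)
    qed (use e in auto)
  qed (auto simp: neighbours_def)
  moreover have "inj_on (\<lambda>w. {v, w}) (V \<inter> neighbours E v)"
    by (auto simp: inj_on_def doubleton_eq_iff)
  moreover have "(E \<inter> Pow V) \<inter> (\<lambda>w. {v, w}) ` (V \<inter> neighbours E v) = {}"
    using assms(3) by auto
  ultimately show ?thesis
    using assms(2) by (simp add: card_Un_disjoint card_image)
qed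

lemma sum_degrees:
  assumes "\<And>e. e \<in> E \<Longrightarrow> card e = 2" "finite V"
  shows "(\<Sum>v\<in>V. card (V \<inter> neighbours E v)) = 2 * card (E \<inter> Pow V)"
  using assms(2)
proof (induction V rule: finite_induct)
  case empty
  have "{} \<notin> E" using assms(1) by force
  then show ?case by auto
next
  case (insert v V)
  have no_loop: "v \<notin> neighbours E v"
    using assms(1)[of "{v}"] by (auto simp: neighbours_def)
  have "card (insert v V \<inter> neighbours E u) = card (V \<inter> neighbours E u) + (if u \<in> neighbours E v then 1 else 0)"
    if "u \<in> V" for u
    using insert.hyps by (auto simp: neighbours_def insert_commute Int_insert_left)
  then have "(\<Sum>u\<in>V. card (insert v V \<inter> neighbours E u)) =
      (\<Sum>u\<in>V. card (V \<inter> neighbours E u)) + card (V \<inter> neighbours E v)"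
    using insert.hyps by (simp add: sum.distrib sum.If_cases Int_def)
  then show ?case
    using insert no_loop by (simp add: card_edges_insert[OF assms(1)] Int_insert_left)
qed

text \<open>A vertex of minimum degree d works: d + 1 is at most the number of vertices, and d times
  that number is at most the degree sum.\<close>

lemma min_degree_edges:
  assumes "\<And>e. e \<in> E \<Longrightarrow> card e = 2" "finite V" "V \<noteq> {}"
  obtains v where "v \<in> V" "card (V \<inter> neighbours E v) < card V"
    "card (V \<inter> neighbours E v) * (card (V \<inter> neighbours E v) + 1) \<le> 2 * card (E \<inter> Pow V)"
proof -
  let ?d = "\<lambda>v. card (V \<inter> neighbours E v)"
  obtain v where v: "v \<in> V" "\<And>u. u \<in> V \<Longrightarrow> ?d v \<le> ?d u"
    using arg_min_if_finite[OF assms(2,3), of ?d] by (metis linorder_not_less)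
  have "v \<notin> neighbours E v"
    using assms(1)[of "{v}"] by (auto simp: neighbours_def)
  then have less: "?d v < card V"
    using v(1) assms(2) by (intro psubset_card_mono) auto
  then have "?d v * (?d v + 1) \<le> ?d v * card V"
    by (intro mult_left_mono) auto
  also have "\<dots> \<le> (\<Sum>u\<in>V. ?d u)"
    using sum_bounded_below[of V "?d v" ?d] v(2) by (simp add: mult.commute)
  finally show thesis
    using that[of v] v(1) less sum_degrees[OF assms(1,2)] by simp
qed

section \<open>Roots of clique sums and the largest root of PC\<close>

lemma clique_sum_at_0:
  assumes "finite V"
  shows "clique_sum V E 0 = 1"
  using assms by (induction V rule: finite_induct) (auto simp: clique_sum_insert)

lemma isCont_clique_sum: "isCont (clique_sum V E) x"
  unfolding clique_sum_def by (intro continuous_intros)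

text \<open>At a least positive root among all induced subgraphs, a maximal induced subgraph with this
  root must be the whole graph: adding a vertex cannot increase the value at this point.\<close>

lemma least_root:
  assumes "finite V" "V \<noteq> {}"
  obtains r where "0 < r" "r \<le> 1" "clique_sum V E r = 0"
    "\<And>H. H \<subseteq> V \<Longrightarrow> 0 \<le> clique_sum H E r"
    "\<And>y. 0 < y \<Longrightarrow> y < r \<Longrightarrow> clique_sum V E y \<noteq> 0"
proof -
  \<comment> \<open>Zeros of all induced subgraphs are collected, not only those of
    \<open>V\<close>, so that minimality of r yields nonnegativity at r for every induced subgraph.
    A single vertex contributes the zero 1.\<close>
  define Z where "Z = {0..1} \<inter> (\<Union>H\<in>Pow V. {y. clique_sum H E y = 0})"
  have "closed {y. clique_sum H E y = 0}" for H
    by (intro closed_Collect_eq continuous_at_imp_continuous_on)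
      (auto simp: isCont_clique_sum intro!: continuous_at_imp_continuous_on)
  then have "compact Z"
    unfolding Z_def using assms(1) by (intro compact_Int_closed closed_UN) auto
  obtain v where "v \<in> V" using assms(2) by blast
  moreover have "clique_sum {v} E 1 = 0"
    by (simp add: clique_sum_insert)
  ultimately have "1 \<in> Z" unfolding Z_def by force
  then obtain r where r: "r \<in> Z" "\<And>y. y \<in> Z \<Longrightarrow> r \<le> y"
    using compact_attains_inf[OF \<open>compact Z\<close>] by blast
  have at_0: "clique_sum H E 0 = 1" if "H \<subseteq> V" for H
    using finite_subset[OF that assms(1)] by (rule clique_sum_at_0)
  have "r \<noteq> 0" using r(1) at_0 by (auto simp: Z_def)
  then have r01: "0 < r" "r \<le> 1" using r(1) by (auto simp: Z_def)
  have nonneg: "0 \<le> clique_sum H E r" if "H \<subseteq> V" for H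
  proof (rule ccontr)
    assume neg: "\<not> 0 \<le> clique_sum H E r"
    \<comment> \<open>Starting from the value 1 at 0, the clique sum would have to vanish before
      becoming negative at r, against the minimality of r.\<close>
    have "\<exists>y\<ge>0. y \<le> r \<and> clique_sum H E y = 0"
      by (rule IVT2) (use neg r01 at_0[OF that] isCont_clique_sum in auto)
    then obtain y where y: "0 \<le> y" "y \<le> r" "clique_sum H E y = 0" by blast
    then have "y \<in> Z"
      using that r01 by (auto simp: Z_def)
    then have "y = r" using r(2)[of y] y(2) by simp
    then show False using y(3) neg by simp
  qed
  have "clique_sum V E r = 0"
  proof -
    let ?S = "{H. H \<subseteq> V \<and> clique_sum H E r = 0}"
    have "finite ?S" using assms(1) by simp
    moreover have "?S \<noteq> {}" using r(1) by (auto simp: Z_def)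
    ultimately have "\<exists>H\<in>?S. \<forall>H'\<in>?S. H \<subseteq> H' \<longrightarrow> H = H'"
      by (rule finite_has_maximal)
    then obtain H where H: "H \<in> ?S" "\<forall>H'\<in>?S. H \<subseteq> H' \<longrightarrow> H = H'" by (elim bexE)
    have "H = V"
    proof (rule ccontr)
      assume "H \<noteq> V"
      then obtain v where v: "v \<in> V" "v \<notin> H" using H(1) by blast
      have sub: "insert v H \<subseteq> V" "H \<inter> neighbours E v \<subseteq> V" using H(1) v by auto
      have "finite H" using H(1) assms(1) finite_subset by blast
      then have "clique_sum (insert v H) E r = - r * clique_sum (H \<inter> neighbours E v) E r"
        using H(1) v(2) by (simp add: clique_sum_insert)
      moreover have "0 \<le> r * clique_sum (H \<inter> neighbours E v) E r"
        using nonneg[OF sub(2)] r01 by simp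
      ultimately have "clique_sum (insert v H) E r = 0"
        using nonneg[OF sub(1)] by simp
      then have "insert v H \<in> ?S" using sub(1) by simp
      then have "H = insert v H" using H(2) by blast
      then show False using v(2) by blast
    qed
    then show ?thesis using H(1) by simp
  qed
  moreover have "clique_sum V E y \<noteq> 0" if "0 < y" "y < r" for y
  proof
    assume "clique_sum V E y = 0"
    then have "y \<in> Z" using that r01 by (auto simp: Z_def)
    then show False using r(2)[of y] that by simp
  qed
  ultimately show thesis using that[of r] r01 nonneg by blast
qed

text \<open>Grouping cliques by size recovers the coefficients of \<open>PC\<close>. Hence its
  nonzero roots are the reciprocals of the nonzero roots of the clique sum.\<close>

lemma poly_PC_eq:
  assumes "finite V" "x \<noteq> 0"
  shows "poly (PC V E) x = x ^ clique_number V E * clique_sum V E (1 / x)"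
proof -
  let ?\<omega> = "clique_number V E"
  have fin: "finite (cliques V E)" using assms(1) by (rule finite_cliques)
  have le: "card K \<le> ?\<omega>" if "K \<in> cliques V E" for K
    unfolding clique_number_def using that fin by (intro Max_ge) auto
  have "clique_sum V E (1 / x) =
      (\<Sum>i\<in>{0..?\<omega>}. \<Sum>K\<in>{K \<in> cliques V E. card K = i}. (- (1 / x)) ^ card K)"
    unfolding clique_sum_def using fin le by (intro sum.group[symmetric]) auto
  also have "\<dots> = (\<Sum>i\<in>{0..?\<omega>}. real (clique_count V E i) * (- (1 / x)) ^ i)"
    by (intro sum.cong) (auto simp: clique_count_def)
  finally have "x ^ ?\<omega> * clique_sum V E (1 / x) =
      (\<Sum>i\<in>{0..?\<omega>}. x ^ ?\<omega> * (real (clique_count V E i) * (- (1 / x)) ^ i))"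
    by (simp add: sum_distrib_left)
  also have "\<dots> = (\<Sum>i\<in>{0..?\<omega>}. (- 1) ^ i * real (clique_count V E i) * x ^ (?\<omega> - i))"
  proof (rule sum.cong)
    fix i assume "i \<in> {0..?\<omega>}"
    then have "x ^ ?\<omega> = x ^ (?\<omega> - i) * x ^ i" by (simp flip: power_add)
    moreover have "(- (1 / x)) ^ i * x ^ i = (- 1) ^ i"
      using assms(2) by (simp flip: power_mult_distrib)
    moreover have "x ^ (?\<omega> - i) * x ^ i * (real (clique_count V E i) * (- (1 / x)) ^ i) =
        (- (1 / x)) ^ i * x ^ i * real (clique_count V E i) * x ^ (?\<omega> - i)"
      by (simp only: mult_ac)
    ultimately show "x ^ ?\<omega> * (real (clique_count V E i) * (- (1 / x)) ^ i) =
        (- 1) ^ i * real (clique_count V E i) * x ^ (?\<omega> - i)"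
      by simp
  qed simp
  also have "\<dots> = poly (PC V E) x"
    by (simp add: PC_def poly_sum poly_monom)
  finally show ?thesis ..
qed

lemma PC_beta_eq_inverse_root:
  assumes "finite V" "0 < r" "clique_sum V E r = 0"
    "\<And>y. 0 < y \<Longrightarrow> y < r \<Longrightarrow> clique_sum V E y \<noteq> 0"
  shows "PC_beta V E = 1 / r"
  unfolding PC_beta_def
proof (rule Max_eqI)
  \<comment> \<open>As r / 2 lies below the least positive root, its reciprocal witnesses that
    \<open>PC V E\<close> is not the zero polynomial; thus the set under \<open>Max\<close> is
    finite.\<close>
  have "clique_sum V E (r / 2) \<noteq> 0" using assms(2,4) by simp
  then have "poly (PC V E) (2 / r) \<noteq> 0"
    using assms(1,2) by (simp add: poly_PC_eq)
  then have "PC V E \<noteq> 0" by auto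
  then show "finite {x. poly (PC V E) x = 0}" by (rule poly_roots_finite)
  show "1 / r \<in> {x. poly (PC V E) x = 0}"
    using assms by (simp add: poly_PC_eq)
next
  fix z assume z: "z \<in> {x. poly (PC V E) x = 0}"
  show "z \<le> 1 / r"
  proof (cases "0 < z")
    case True
    then have "clique_sum V E (1 / z) = 0"
      using z assms(1) by (simp add: poly_PC_eq)
    then have "r \<le> 1 / z" using assms(4)[of "1 / z"] True by force
    then show ?thesis using True assms(2) by (simp add: field_simps)
  next
    case False
    moreover have "0 < 1 / r" using assms(2) by simp
    ultimately show ?thesis by linarith
  qed
qed

subsection \<open>Comparison with a clique and isolated vertices\<close>

lemma exp_minus_le_quadratic:
  fixes z :: real
  assumes "0 \<le> z"
  shows "exp (- z) \<le> 1 - z + z\<^sup>2 / 2"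
proof -
  have pos: "0 < 1 - z + z\<^sup>2 / 2"
    using zero_le_power2[of "z - 1"] by (simp add: power2_diff)
  have "(1 - z + z\<^sup>2 / 2) * (1 + z + z\<^sup>2 / 2) = 1 + (z\<^sup>2)\<^sup>2 / 4"
    by (simp add: algebra_simps power2_eq_square)
  then have "1 \<le> (1 - z + z\<^sup>2 / 2) * (1 + z + z\<^sup>2 / 2)" by simp
  also have "\<dots> \<le> (1 - z + z\<^sup>2 / 2) * exp z"
    using pos exp_lower_Taylor_quadratic[OF assms] by (intro mult_left_mono) auto
  finally show ?thesis by (simp add: exp_minus divide_simps)
qed

text \<open>The quadratic bounds for exp z and exp (- z) differ by exactly 2 z. This is z \<le> sinh
  z, the source of the midpoint estimate below.\<close>

lemma exp_diff_ge:
  fixes z :: real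
  assumes "0 \<le> z"
  shows "2 * z \<le> exp z - exp (- z)"
  using exp_minus_le_quadratic[OF assms] exp_lower_Taylor_quadratic[OF assms] by linarith

text \<open>The product (1 - x) exp (x + x^2 / 2) is 1 at 0 and has derivative - x^2 exp (x + x^2 /
  2).\<close>

lemma one_minus_le_exp_quadratic:
  fixes x :: real
  assumes "0 \<le> x"
  shows "1 - x \<le> exp (- x - x\<^sup>2 / 2)"
proof -
  let ?f = "\<lambda>x::real. (1 - x) * exp (x + x\<^sup>2 / 2)"
  have "?f x \<le> ?f 0"
  proof (rule DERIV_nonpos_imp_nonincreasing[OF assms])
    fix y :: real
    have "DERIV ?f y :> - (y\<^sup>2 * exp (y + y\<^sup>2 / 2))"
      by (auto intro!: derivative_eq_intros simp: algebra_simps power2_eq_square)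
    then show "\<exists>d. DERIV ?f y :> d \<and> d \<le> 0" by force
  qed
  then have "(1 - x) * exp (x + x\<^sup>2 / 2) \<le> 1" by simp
  moreover have "exp (- x - x\<^sup>2 / 2) * exp (x + x\<^sup>2 / 2) = 1"
    by (simp flip: exp_add)
  ultimately show ?thesis
    by (metis exp_gt_zero mult_le_cancel_right_pos)
qed

lemma one_minus_exp_mult_le:
  fixes y :: real
  assumes "0 \<le> y"
  shows "1 - exp (- y) * (1 + y) \<le> y\<^sup>2 / 2"
proof -
  let ?f = "\<lambda>y::real. exp (- y) * (1 + y) + y\<^sup>2 / 2"
  have "?f 0 \<le> ?f y"
  proof (rule DERIV_nonneg_imp_nondecreasing[OF assms])
    fix z :: real assume "0 \<le> z"
    then have "0 \<le> z * (1 - exp (- z))" by simp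
    moreover have "DERIV ?f z :> z * (1 - exp (- z))"
      by (auto intro!: derivative_eq_intros simp: algebra_simps)
    ultimately show "\<exists>d. DERIV ?f z :> d \<and> 0 \<le> d" by blast
  qed
  then show ?thesis by simp
qed

lemma exp_1_less: "exp 1 < (2.75 :: real)"
proof -
  have "exp (- 1 :: real) > 4 / 11"
  proof -
    obtain t :: real where "exp (- 1) = (\<Sum>m<6. (- 1) ^ m / fact m) + exp t / fact 6 * (- 1) ^ 6"
      using Maclaurin_exp_le[of "- 1" 6] by blast
    then have "exp (- 1 :: real) > (\<Sum>m<6. (- 1) ^ m / fact m)" by simp
    then show ?thesis by (simp add: eval_nat_numeral)
  qed
  then show ?thesis by (simp add: exp_minus field_simps)
qed

text \<open>The quadratic term in the bound on 1 - x contributes a factor exp (- z) with z = b x^2 /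
  2. The resulting surplus x^2 / 8 pays for the error made in
  \<open>clique_profile_step\<close>.\<close>

lemma one_minus_power_le:
  fixes x :: real
  assumes "2 \<le> b" "0 \<le> x" "x * (real b + 1) \<le> 2"
  shows "(1 - x) ^ b \<le> exp (- (real b * x)) - x\<^sup>2 / 8"
proof -
  have "x * 3 \<le> x * (real b + 1)" using assms by (intro mult_left_mono) auto
  then have x: "x \<le> 2 / 3" using assms(3) by simp
  have bx: "real b * x \<le> 2" using assms(2,3) by (simp add: algebra_simps)
  define z where "z = real b * x\<^sup>2 / 2"
  have "real b * x * x \<le> 2 * (2 / 3)" using bx x assms(2) by (intro mult_mono) auto
  then have z: "0 \<le> z" "z \<le> 2 / 3" by (simp_all add: z_def power2_eq_square)
  \<comment> \<open>Since 1 - z / 2 \<ge> 2 / 3, the surplus x^2 / 8 needs exactly this bound. For b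
    \<ge> 3 it follows from b x \<le> 2 and 2.75^2 < 8; for b = 2 that is too weak, but then b x
    \<le> 4 / 3.\<close>
  have exp_le: "exp (real b * x) \<le> 8 / 3 * real b"
  proof (cases "b = 2")
    case True
    then have "exp (real b * x) \<le> exp (1 + 1 / 3)" using x by simp
    also have "\<dots> = exp 1 / exp (- (1 / 3))" by (simp flip: exp_diff)
    also have "\<dots> \<le> 2.75 / (1 - 1 / 3)"
      using exp_1_less exp_ge_add_one_self[of "- (1 / 3) :: real"] by (intro frac_le) auto
    finally show ?thesis using True by simp
  next
    case False
    have "exp (real b * x) \<le> exp (1 + 1)" using bx by simp
    also have "\<dots> = exp 1 * exp 1" by (rule exp_add)
    also have "\<dots> \<le> 2.75 * 2.75" using exp_1_less by (intro mult_mono) auto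
    finally show ?thesis using False assms(1) by (auto simp: power2_eq_square)
  qed
  have "(1 - x) ^ b \<le> exp (- x - x\<^sup>2 / 2) ^ b"
    using x one_minus_le_exp_quadratic[OF assms(2)] by (intro power_mono) auto
  also have "\<dots> = exp (- (real b * x)) * exp (- z)"
    by (simp add: z_def algebra_simps flip: exp_of_nat_mult exp_add)
  also have "\<dots> \<le> exp (- (real b * x)) * (1 - z + z\<^sup>2 / 2)"
    using exp_minus_le_quadratic[OF z(1)] by (intro mult_left_mono) auto
  also have "\<dots> = exp (- (real b * x)) - exp (- (real b * x)) * (z * (1 - z / 2))"
    by (simp add: algebra_simps power2_eq_square)
  also have "\<dots> \<le> exp (- (real b * x)) - x\<^sup>2 / 8"
  proof -
    have "x\<^sup>2 / 8 * exp (real b * x) \<le> x\<^sup>2 / 8 * (8 / 3 * real b)"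
      using exp_le by (intro mult_left_mono) auto
    also have "\<dots> = z * (2 / 3)" by (simp add: z_def)
    also have "\<dots> \<le> z * (1 - z / 2)" using z by (intro mult_left_mono) auto
    finally have "exp (- (real b * x)) * (x\<^sup>2 / 8 * exp (real b * x)) \<le> exp (- (real b * x)) * (z * (1 - z / 2))"
      by (intro mult_left_mono) auto
    moreover have "exp (- (real b * x)) * (x\<^sup>2 / 8 * exp (real b * x)) = x\<^sup>2 / 8"
      by (simp add: exp_minus)
    ultimately show ?thesis by linarith
  qed
  finally show ?thesis .
qed

text \<open>With d = s - s' and m the midpoint, m d = b; the left-hand side is the integral of
  x (1 - exp (- u x)) over u between s' and s, which is compared with the value at m.\<close>

lemma clique_profile_step:
  fixes x s s' :: real and b :: nat
  assumes x: "0 < x" "x \<le> 1" "x * (real b + 1) \<le> 2" and "1 \<le> b"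
    and "0 \<le> s" "0 \<le> s'" and diff: "s\<^sup>2 - s'\<^sup>2 = 2 * real b"
    and ge: "real b * (real b + 1) \<le> s\<^sup>2"
  shows "(exp (- (s * x)) + s * x) - (exp (- (s' * x)) + s' * x) \<le> x * (1 - (1 - x) ^ b)"
proof -
  define d where "d = s - s'"
  define m where "m = (s + s') / 2"
  have md: "m * d = real b"
    using diff by (simp add: m_def d_def power2_eq_square algebra_simps)
  have "0 \<le> m" using assms by (simp add: m_def)
  moreover have "0 < m * d" using md \<open>1 \<le> b\<close> by simp
  ultimately have pos: "0 < m" "0 < d" by (auto simp: zero_less_mult_iff)
  have sum: "exp (- (s' * x)) - exp (- (s * x)) = exp (- (m * x)) * (exp (d * x / 2) - exp (- (d * x / 2)))"
    by (simp add: m_def d_def algebra_simps field_simps flip: exp_add)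
  \<comment> \<open>Midpoint estimate for the concave function 1 - exp (- u x) of u, obtained from z
    \<le> sinh z at z = d x / 2.\<close>
  have "exp (- (m * x)) * (d * x) \<le> exp (- (s' * x)) - exp (- (s * x))"
    unfolding sum using exp_diff_ge[of "d * x / 2"] pos x by (intro mult_left_mono) auto
  then have mid: "(exp (- (s * x)) + s * x) - (exp (- (s' * x)) + s' * x) \<le> x * (d * (1 - exp (- (m * x))))"
    by (simp add: d_def algebra_simps)
  have "d * (1 - exp (- (m * x))) \<le> 1 - (1 - x) ^ b"
  proof (cases "b = 1")
    case True
    have "d * (1 - exp (- (m * x))) \<le> d * (m * x)"
      using exp_ge_add_one_self[of "- (m * x)"] pos by (intro mult_left_mono) auto
    also have "\<dots> = x" using md True by (simp add: mult_ac)
    finally show ?thesis using True by simp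
  next
    case False
    then have b: "2 \<le> b" using \<open>1 \<le> b\<close> by simp
    define r where "r = real b"
    have r: "2 \<le> r" using b by (simp add: r_def)
    \<comment> \<open>In the extreme case the squares of s and s' are r (r + 1) and r (r - 1), and d
      exceeds 1 by about 1 / (8 r^2). Because m d = r, a lower bound on m suffices.\<close>
    have d_le: "d - 1 \<le> 1 / (4 * r\<^sup>2)"
    proof -
      have "(r + 1 / 2 - 1 / (8 * r))\<^sup>2 = r * (r + 1) - (1 / (8 * r)) * (1 - 1 / (8 * r))"
        using r by (simp add: power2_eq_square field_simps)
      also have "\<dots> \<le> r * (r + 1)" using r by (simp add: field_simps)
      also have "\<dots> \<le> s\<^sup>2" using ge by (simp add: r_def)
      finally have s1: "r + 1 / 2 - 1 / (8 * r) \<le> s"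
        using \<open>0 \<le> s\<close> by (rule power2_le_imp_le)
      \<comment> \<open>The expansion of sqrt (r (r - 1)) has the term - 1 / (8 r), but cutting it
        off there overshoots the root; 1 / (4 r) makes it a lower bound.\<close>
      have "(r - 1 / 2 - 1 / (4 * r))\<^sup>2 = r * (r - 1) - (1 / 4 - 1 / (4 * r) - 1 / (4 * r) * (1 / (4 * r)))"
        using r by (simp add: power2_eq_square field_simps)
      also have "\<dots> \<le> r * (r - 1)"
      proof -
        have "1 / (4 * r) \<le> 1 / 8" using r by (simp add: field_simps)
        moreover then have "1 / (4 * r) * (1 / (4 * r)) \<le> 1 / 8 * (1 / 8)"
          using r by (intro mult_mono) auto
        ultimately show ?thesis by simp
      qed
      also have "\<dots> \<le> s'\<^sup>2" using ge diff by (simp add: r_def algebra_simps)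
      finally have s2: "r - 1 / 2 - 1 / (4 * r) \<le> s'"
        using \<open>0 \<le> s'\<close> by (rule power2_le_imp_le)
      have "r \<le> (1 + 1 / (4 * r\<^sup>2)) * (r - 3 / (16 * r))"
      proof -
        have "(1 + 1 / (4 * r\<^sup>2)) * (r - 3 / (16 * r)) = r + 1 / (16 * r) * (1 - 3 / (4 * r\<^sup>2))"
          using r by (simp add: power2_eq_square field_simps)
        moreover have "3 / (4 * r\<^sup>2) \<le> 1"
          using power_mono[OF r, of 2] r by (simp add: divide_simps)
        ultimately show ?thesis using r by simp
      qed
      also have "\<dots> \<le> (1 + 1 / (4 * r\<^sup>2)) * m"
        using s1 s2 by (intro mult_left_mono) (auto simp: m_def field_simps)
      finally have "m * d \<le> m * (1 + 1 / (4 * r\<^sup>2))" using md by (simp add: r_def mult.commute)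
      then show ?thesis using pos by simp
    qed
    define y where "y = r * x"
    have y: "0 \<le> y" using r x by (simp add: y_def)
    \<comment> \<open>The exponential is replaced by its tangent at - y. As d m x = y, what remains
      beyond 1 - exp (- y) is d - 1 times a factor between 0 and y^2 / 2, hence at most x^2 / 8, the
      surplus of \<open>one_minus_power_le\<close>.\<close>
    have "exp (- y) * (1 + y - m * x) \<le> exp (- y) * exp (y - m * x)"
      using exp_ge_add_one_self[of "y - m * x"] by (intro mult_left_mono) (auto simp: algebra_simps)
    also have "\<dots> = exp (- (m * x))" by (simp flip: exp_add)
    finally have "d * (1 - exp (- (m * x))) \<le> d * (1 - exp (- y) * (1 + y - m * x))"
      using pos by (intro mult_left_mono) auto
    also have "\<dots> = d - exp (- y) * (d * (1 + y) - (m * d) * x)"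
      by (simp add: algebra_simps)
    also have "\<dots> = (1 - exp (- y)) + (d - 1) * (1 - exp (- y) * (1 + y))"
      unfolding md y_def r_def by (simp add: algebra_simps)
    also have "\<dots> \<le> (1 - exp (- y)) + 1 / (4 * r\<^sup>2) * (y\<^sup>2 / 2)"
    proof -
      have "exp (- y) * (1 + y) \<le> exp (- y) * exp y"
        using exp_ge_add_one_self[of y] by (intro mult_left_mono) auto
      then have "0 \<le> 1 - exp (- y) * (1 + y)" by (simp flip: exp_add)
      then have "(d - 1) * (1 - exp (- y) * (1 + y)) \<le> 1 / (4 * r\<^sup>2) * (1 - exp (- y) * (1 + y))"
        using d_le by (intro mult_right_mono)
      also have "\<dots> \<le> 1 / (4 * r\<^sup>2) * (y\<^sup>2 / 2)"
        using one_minus_exp_mult_le[OF y] by (intro mult_left_mono) auto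
      finally show ?thesis by simp
    qed
    also have "1 / (4 * r\<^sup>2) * (y\<^sup>2 / 2) = x\<^sup>2 / 8"
      using r by (simp add: y_def power_mult_distrib)
    finally show ?thesis
      using one_minus_power_le[OF b _ x(3)] x(1) by (simp add: y_def r_def)
  qed
  then have "x * (d * (1 - exp (- (m * x)))) \<le> x * (1 - (1 - x) ^ b)"
    using x(1) by (intro mult_left_mono) auto
  with mid show ?thesis by linarith
qed

text \<open>Induction on the number of vertices, removing one of minimum degree b. The recursion
  costs at most x (1 - x)^b, and \<open>clique_profile_step\<close> shows that the left-hand side
  drops at least as much. An isolated vertex leaves s unchanged and costs x on both sides.\<close>

lemma clique_sum_lower:
  fixes x :: real
  assumes edges: "\<And>e. e \<in> E \<Longrightarrow> card e = 2" and x: "0 < x" "x \<le> 1"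
    and "finite V" "x * real (card V) \<le> 2" "\<And>H. H \<subseteq> V \<Longrightarrow> 0 \<le> clique_sum H E x"
    and "s = sqrt (2 * real (card (E \<inter> Pow V)))"
  shows "exp (- (s * x)) + s * x - real (card V) * x \<le> clique_sum V E x"
  using assms(4-7)
proof (induction "card V" arbitrary: V s)
  case 0
  then have "V = {}" by simp
  moreover have "{} \<notin> E" using edges by force
  ultimately show ?case using 0 by (simp add: Int_insert_right)
next
  case (Suc n)
  have "V \<noteq> {}" using Suc.hyps(2) by auto
  then obtain v where v: "v \<in> V" "card (V \<inter> neighbours E v) < card V"
    "card (V \<inter> neighbours E v) * (card (V \<inter> neighbours E v) + 1) \<le> 2 * card (E \<inter> Pow V)"
    using min_degree_edges[OF edges Suc.prems(1)] by metis
  define W where "W = V - {v}"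
  have W: "V = insert v W" "v \<notin> W" "finite W" using v(1) Suc.prems(1) by (auto simp: W_def)
  have card_V: "card V = Suc (card W)" using W by simp
  have "v \<notin> neighbours E v"
    using edges[of "{v}"] by (auto simp: neighbours_def)
  then have nb: "V \<inter> neighbours E v = W \<inter> neighbours E v" using W(1) by auto
  define b where "b = card (W \<inter> neighbours E v)"
  define s' where "s' = sqrt (2 * real (card (E \<inter> Pow W)))"
  have edge_count: "card (E \<inter> Pow V) = card (E \<inter> Pow W) + b"
    unfolding b_def W(1) using card_edges_insert[OF edges W(3,2)] .
  have nonneg: "0 \<le> clique_sum H E x" if "H \<subseteq> W" for H
    using Suc.prems(3) that W(1) by blast
  have "x * real (card W) \<le> x * real (card V)" using x(1) card_V by (intro mult_left_mono) auto
  then have IH: "exp (- (s' * x)) + s' * x - real (card W) * x \<le> clique_sum W E x"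
    using Suc.hyps(2) card_V W(3) Suc.prems(2) nonneg by (intro Suc.hyps(1) s'_def) auto
  have "clique_sum (W \<inter> neighbours E v) E x \<le> (1 - x) ^ b"
    unfolding b_def using W(3) x nonneg by (intro clique_sum_le_power) auto
  then have "x * clique_sum (W \<inter> neighbours E v) E x \<le> x * (1 - x) ^ b"
    using x(1) by (intro mult_left_mono) auto
  then have rec: "clique_sum W E x - x * (1 - x) ^ b \<le> clique_sum V E x"
    unfolding W(1) clique_sum_insert[OF W(3,2)] by simp
  have "(exp (- (s * x)) + s * x) - (exp (- (s' * x)) + s' * x) \<le> x * (1 - (1 - x) ^ b)"
  proof (cases "b = 0")
    case True
    then show ?thesis using edge_count by (simp add: Suc.prems(4) s'_def)
  next
    case False
    show ?thesis
    proof (rule clique_profile_step)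
      have "x * (real b + 1) \<le> x * real (card V)"
        using v(2) x(1) unfolding nb b_def[symmetric] by (intro mult_left_mono) auto
      then show "x * (real b + 1) \<le> 2" using Suc.prems(2) by simp
      show "1 \<le> b" using False by simp
      show "s\<^sup>2 - s'\<^sup>2 = 2 * real b" using edge_count by (simp add: Suc.prems(4) s'_def)
      have "real (b * (b + 1)) \<le> real (2 * card (E \<inter> Pow V))"
        using v(3) unfolding nb b_def[symmetric] by (simp only: of_nat_le_iff)
      then show "real b * (real b + 1) \<le> s\<^sup>2" by (simp add: Suc.prems(4) algebra_simps)
    qed (use x Suc.prems(4) s'_def in auto)
  qed
  then show ?case using IH rec card_V by (simp add: algebra_simps)
qed

subsection \<open>The minimum of PC_f\<close>

text \<open>This is \<open>PC_f\<close> in the parameter w = W (1 / (t - 1)), that is, t = 1 + exp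
  (- w) / w, which eliminates the Lambert function.\<close>

definition clique_ratio :: "real \<Rightarrow> real" where
  "clique_ratio w = 2 * (w + exp (- w)) * (w + exp (- w) - 1) / w\<^sup>2"

lemma lambert_W_eq:
  assumes "0 \<le> w"
  shows "lambert_W (w * exp w) = w"
  unfolding lambert_W_def
proof (rule the_inv_into_f_f)
  have "a * exp a < b * exp b" if "0 \<le> a" "a < b" for a b :: real
    using that by (intro mult_strict_mono) auto
  then show "inj_on (\<lambda>y::real. y * exp y) {0..}"
    by (intro inj_onI) (metis atLeast_iff less_irrefl linorder_neqE)
qed (use assms in auto)

lemma PC_f_eq_clique_ratio:
  assumes "0 < w"
  shows "PC_f (1 + exp (- w) / w) = clique_ratio w"
proof -
  have "1 / (exp (- w) / w) = w * exp w" using assms by (simp add: exp_minus field_simps)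
  then have "lambert_W (1 / (1 + exp (- w) / w - 1)) = w" using lambert_W_eq assms by simp
  then show ?thesis
    using assms by (simp add: PC_f_def clique_ratio_def power2_eq_square field_simps)
qed

lemma PC_f_image: "PC_f ` {1<..} = clique_ratio ` {0<..}"
proof (intro equalityI image_subsetI)
  fix t :: real assume "t \<in> {1<..}"
  then have c: "0 < 1 / (t - 1)" by simp
  define c where "c = 1 / (t - 1)"
  \<comment> \<open>The interval from 0 to c suffices because c exp c \<ge> c.\<close>
  have "\<exists>w\<ge>0. w \<le> c \<and> w * exp w = c"
    by (rule IVT) (use c in \<open>auto simp: c_def[symmetric]\<close>)
  then obtain w where w: "0 \<le> w" "w * exp w = c" by blast
  have "w \<noteq> 0" using w c by (auto simp: c_def[symmetric])
  with w have "0 < w" by simp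
  moreover have "t = 1 + exp (- w) / w"
  proof -
    have "exp (- w) / w = 1 / (w * exp w)" by (simp add: exp_minus field_simps)
    then show ?thesis using w(2) c by (simp add: c_def)
  qed
  ultimately show "PC_f t \<in> clique_ratio ` {0<..}"
    using PC_f_eq_clique_ratio by simp
next
  fix w :: real assume "w \<in> {0<..}"
  then have "clique_ratio w = PC_f (1 + exp (- w) / w)" "1 < 1 + exp (- w) / w"
    using PC_f_eq_clique_ratio by simp_all
  then show "clique_ratio w \<in> PC_f ` {1<..}" by blast
qed

text \<open>In terms of t = (sqrt (1 + c w^2) - 1) / w, the inequality c / 2 \<le> clique_ratio w
  becomes 0 \<le> log_gap c t, and the derivative of log_gap is a rational function.\<close>

definition log_gap :: "real \<Rightarrow> real \<Rightarrow> real" where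
  "log_gap c t = ln (c - t\<^sup>2) - ln (c - 2 * t) - 2 * t / (c - t\<^sup>2)"

text \<open>The factor of the derivative of \<open>log_gap\<close> that decides its sign; the
  remaining factors are positive for t > 0 in the domain.\<close>

definition log_gap_slope :: "real \<Rightarrow> real \<Rightarrow> real" where
  "log_gap_slope c t = c * (2 - c) - c * t + (c + 2) * t\<^sup>2 - t ^ 3"

lemma log_gap_domain:
  fixes c t :: real
  assumes "0 \<le> t" "2 * t < c" "c \<le> 2"
  shows "0 < c - 2 * t" "0 < c - t\<^sup>2"
proof -
  show "0 < c - 2 * t" using assms(2) by simp
  have "t * t \<le> 1 * t" using assms by (intro mult_right_mono) auto
  then show "0 < c - t\<^sup>2" using assms by (simp add: power2_eq_square)
qed

lemma DERIV_log_gap: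
  assumes "0 \<le> t" "2 * t < c" "c \<le> 2"
  shows "DERIV (log_gap c) t :> 2 * t * log_gap_slope c t / ((c - t\<^sup>2)\<^sup>2 * (c - 2 * t))"
proof -
  note pos = log_gap_domain[OF assms]
  have "DERIV (log_gap c) t :>
      - (2 * t) / (c - t\<^sup>2) + 2 / (c - 2 * t) - (2 * (c - t\<^sup>2) + 4 * t\<^sup>2) / (c - t\<^sup>2)\<^sup>2"
    unfolding log_gap_def[abs_def] using pos
    by (auto intro!: derivative_eq_intros simp: power2_eq_square)
  also have "- (2 * t) / (c - t\<^sup>2) + 2 / (c - 2 * t) - (2 * (c - t\<^sup>2) + 4 * t\<^sup>2) / (c - t\<^sup>2)\<^sup>2 =
      (- (2 * t) * ((c - t\<^sup>2) * (c - 2 * t)) + 2 * (c - t\<^sup>2)\<^sup>2 - (2 * (c - t\<^sup>2) + 4 * t\<^sup>2) * (c - 2 * t))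
        / ((c - t\<^sup>2)\<^sup>2 * (c - 2 * t))"
    using pos by (simp add: divide_simps) (simp add: power2_eq_square algebra_simps)
  also have "- (2 * t) * ((c - t\<^sup>2) * (c - 2 * t)) + 2 * (c - t\<^sup>2)\<^sup>2 - (2 * (c - t\<^sup>2) + 4 * t\<^sup>2) * (c - 2 * t) =
      2 * t * log_gap_slope c t"
    by (simp add: log_gap_slope_def power2_eq_square power3_eq_cube algebra_simps)
  finally show ?thesis .
qed

lemma log_gap_mono:
  assumes "0 \<le> a" "a \<le> b" "2 * b < c" "c \<le> 2"
    and "\<And>t. a \<le> t \<Longrightarrow> t \<le> b \<Longrightarrow> 0 \<le> log_gap_slope c t"
  shows "log_gap c a \<le> log_gap c b"
proof (rule DERIV_nonneg_imp_nondecreasing[OF \<open>a \<le> b\<close>])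
  fix t assume "a \<le> t" "t \<le> b"
  then have t: "0 \<le> t" "2 * t < c" using assms by auto
  note pos = log_gap_domain[OF t \<open>c \<le> 2\<close>]
  then have "0 \<le> 2 * t * log_gap_slope c t / ((c - t\<^sup>2)\<^sup>2 * (c - 2 * t))"
    using t assms(5) \<open>a \<le> t\<close> \<open>t \<le> b\<close> by (intro divide_nonneg_pos mult_nonneg_nonneg mult_pos_pos) auto
  then show "\<exists>y. DERIV (log_gap c) t :> y \<and> 0 \<le> y"
    using DERIV_log_gap[OF t \<open>c \<le> 2\<close>] by blast
qed

lemma log_gap_antimono:
  assumes "0 \<le> a" "a \<le> b" "2 * b < c" "c \<le> 2"
    and "\<And>t. a \<le> t \<Longrightarrow> t \<le> b \<Longrightarrow> log_gap_slope c t \<le> 0"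
  shows "log_gap c b \<le> log_gap c a"
proof (rule DERIV_nonpos_imp_nonincreasing[OF \<open>a \<le> b\<close>])
  fix t assume "a \<le> t" "t \<le> b"
  then have t: "0 \<le> t" "2 * t < c" using assms by auto
  note pos = log_gap_domain[OF t \<open>c \<le> 2\<close>]
  then have "2 * t * log_gap_slope c t / ((c - t\<^sup>2)\<^sup>2 * (c - 2 * t)) \<le> 0"
    using t assms(5) \<open>a \<le> t\<close> \<open>t \<le> b\<close> by (intro divide_nonpos_pos mult_nonneg_nonpos mult_pos_pos) auto
  then show "\<exists>y. DERIV (log_gap c) t :> y \<and> y \<le> 0"
    using DERIV_log_gap[OF t \<open>c \<le> 2\<close>] by blast
qed

lemma log_gap_slope_diff:
  "log_gap_slope c t - log_gap_slope c a = (t - a) * ((c + 2) * (t + a) - c - (t\<^sup>2 + t * a + a\<^sup>2))"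
  by (simp add: log_gap_slope_def power2_eq_square power3_eq_cube algebra_simps)

text \<open>Interpolation error of a cubic, with second divided difference c + 2 - t - a - b. Where
  this is positive, the cubic lies below its chord.\<close>

lemma log_gap_slope_chord:
  "log_gap_slope c t * (b - a) = (b - t) * log_gap_slope c a + (t - a) * log_gap_slope c b
     - (t - a) * (b - t) * (b - a) * (c + 2 - t - a - b)"
  by (simp add: log_gap_slope_def power2_eq_square power3_eq_cube algebra_simps)

text \<open>The constant is slightly below 2 PC_alpha, and 0.3564 slightly to the left of the local
  minimum of log_gap.\<close>

lemma log_gap_nonneg:
  fixes c t :: real
  assumes c: "c = 1.88160142" and t: "0 \<le> t" "2 * t < c"
  shows "0 \<le> log_gap c t"
proof -
  define a b :: real where "a = 0.3564" and "b = 0.3566"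
  have c2: "c \<le> 2" using c by simp
  have slope_mono: "log_gap_slope c p \<le> log_gap_slope c t"
    if "a \<le> p" "p \<le> b" "p \<le> t" "t \<le> 1" for p t
  proof -
    have "t * t \<le> 1 * t" "t * p \<le> t * b" "p * p \<le> b * p"
      using that by (auto simp: a_def intro!: mult_right_mono mult_left_mono)
    then have "t\<^sup>2 + t * p + p\<^sup>2 \<le> t + t * b + b * p"
      by (simp add: power2_eq_square)
    also have "\<dots> \<le> (c + 2) * (t + p) - c"
      using that by (simp add: c a_def b_def field_simps)
    finally have "0 \<le> (t - p) * ((c + 2) * (t + p) - c - (t\<^sup>2 + t * p + p\<^sup>2))"
      using that by simp
    then show ?thesis using log_gap_slope_diff[of c t p] by simp
  qed
  \<comment> \<open>The number 0.40625097 exceeds 2 a / (c - a^2) by at least 3 / 10^9. Ten Taylor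
    terms leave a remainder with an even power, so the partial sum is a lower bound.\<close>
  have gap_a: "3 / 10 ^ 9 \<le> log_gap c a"
  proof -
    have "(\<Sum>m<10. (- 0.40625097) ^ m / fact m) \<le> exp (- 0.40625097 :: real)"
    proof -
      obtain z :: real where "exp (- 0.40625097) =
          (\<Sum>m<10. (- 0.40625097) ^ m / fact m) + exp z / fact 10 * (- 0.40625097) ^ 10"
        using Maclaurin_exp_le[of "- 0.40625097" 10] by blast
      then show ?thesis by simp
    qed
    moreover have "(c - 2 * a) / (c - a\<^sup>2) \<le> (\<Sum>m<10. (- 0.40625097) ^ m / fact m)"
      by (simp add: c a_def eval_nat_numeral)
    ultimately have "(c - 2 * a) / (c - a\<^sup>2) \<le> exp (- 0.40625097)" by linarith
    moreover have "0 < (c - 2 * a) / (c - a\<^sup>2)" by (simp add: c a_def power2_eq_square)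
    ultimately have "ln ((c - 2 * a) / (c - a\<^sup>2)) \<le> ln (exp (- 0.40625097))" by (intro ln_mono) auto
    then have "ln ((c - 2 * a) / (c - a\<^sup>2)) \<le> - 0.40625097" by simp
    then show ?thesis
      by (simp add: log_gap_def ln_div c a_def power2_eq_square)
  qed
  show ?thesis
  proof (cases "t \<le> a")
    case True
    \<comment> \<open>The root r of the slope is the local maximum of \<open>log_gap\<close>: the
      function rises from its value 0 at 0 up to r and then falls until a.\<close>
    have "\<exists>r\<ge>0.18. r \<le> 0.19 \<and> log_gap_slope c r = 0"
      by (rule IVT2) (auto simp: log_gap_slope_def c power2_eq_square power3_eq_cube intro!: continuous_intros)
    then obtain r where r: "0.18 \<le> r" "r \<le> 0.19" "log_gap_slope c r = 0" by blast
    show ?thesis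
    proof (cases "t \<le> r")
      case True
      have "0 \<le> log_gap_slope c y" if "0 \<le> y" "y \<le> t" for y
      proof -
        have "y \<le> r" using that True by simp
        have "y + r \<le> 0.38" using \<open>y \<le> r\<close> r by simp
        then have "(c + 2) * (y + r) \<le> c" by (simp add: c field_simps)
        moreover have "0 \<le> y\<^sup>2 + y * r + r\<^sup>2" using that r by simp
        ultimately have "(c + 2) * (y + r) - c - (y\<^sup>2 + y * r + r\<^sup>2) \<le> 0" by linarith
        then have "0 \<le> (y - r) * ((c + 2) * (y + r) - c - (y\<^sup>2 + y * r + r\<^sup>2))"
          using \<open>y \<le> r\<close> by (intro mult_nonpos_nonpos) auto
        then show ?thesis using log_gap_slope_diff[of c y r] r(3) by simp
      qed
      then have "log_gap c 0 \<le> log_gap c t" using t c2 by (intro log_gap_mono) auto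
      then show ?thesis by (simp add: log_gap_def)
    next
      case False
      have "log_gap_slope c y \<le> 0" if "t \<le> y" "y \<le> a" for y
      proof -
        \<comment> \<open>The chord from r to a is nonpositive, and the cubic lies below it.\<close>
        have "log_gap_slope c a \<le> 0" by (simp add: log_gap_slope_def c a_def power2_eq_square power3_eq_cube)
        then have "(y - r) * log_gap_slope c a \<le> 0"
          using that False by (intro mult_nonneg_nonpos) auto
        moreover have "0 \<le> (y - r) * (a - y) * (a - r) * (c + 2 - y - r - a)"
          using that False r by (intro mult_nonneg_nonneg) (auto simp: c a_def)
        ultimately have "log_gap_slope c y * (a - r) \<le> 0"
          using log_gap_slope_chord[of c y a r] r(3) by simp
        moreover have "0 < a - r" using r by (simp add: a_def)
        ultimately show ?thesis by (simp add: mult_le_0_iff)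
      qed
      then have "log_gap c a \<le> log_gap c t" using t c2 \<open>t \<le> a\<close> by (intro log_gap_antimono) (auto simp: a_def c)
      then show ?thesis using gap_a by simp
    qed
  next
    case False
    have near: "0 \<le> log_gap c y" if "a \<le> y" "y \<le> b" for y
    proof -
      \<comment> \<open>The local minimum is not located exactly. Between a and b the derivative is
        at least - 1 / 10^5, so \<open>log_gap\<close> loses at most 2 / 10^9 over the length
        0.0002, less than its value at a.\<close>
      let ?f = "\<lambda>t. log_gap c t + t / 10 ^ 5"
      have "?f a \<le> ?f y"
      proof (rule DERIV_nonneg_imp_nondecreasing[OF \<open>a \<le> y\<close>])
        fix z assume "a \<le> z" "z \<le> y"
        then have z: "0 \<le> z" "2 * z < c" "z \<le> b" using that by (auto simp: a_def b_def c)
        note pos = log_gap_domain[OF z(1,2) c2]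
        have "- (5 / 10 ^ 5) \<le> log_gap_slope c a"
          by (simp add: log_gap_slope_def c a_def power2_eq_square power3_eq_cube)
        also have "\<dots> \<le> log_gap_slope c z"
          using \<open>a \<le> z\<close> z(3) by (intro slope_mono) (auto simp: a_def b_def)
        finally have slope: "- (5 / 10 ^ 5) \<le> log_gap_slope c z" .
        have "z\<^sup>2 \<le> b\<^sup>2" using z by (intro power_mono) auto
        then have "(c - b\<^sup>2)\<^sup>2 * (c - 2 * b) \<le> (c - z\<^sup>2)\<^sup>2 * (c - 2 * z)"
          using z by (intro mult_mono power_mono) (auto simp: c b_def power2_eq_square)
        then have "3.57 \<le> (c - z\<^sup>2)\<^sup>2 * (c - 2 * z)"
          by (simp add: c b_def power2_eq_square)
        moreover have "- (3.57 / 10 ^ 5) \<le> 2 * z * log_gap_slope c z"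
        proof -
          have "2 * z * - (5 / 10 ^ 5) \<le> 2 * z * log_gap_slope c z"
            using slope z by (intro mult_left_mono) auto
          then show ?thesis using z(3) by (simp add: b_def)
        qed
        ultimately have "0 \<le> 2 * z * log_gap_slope c z + 1 / 10 ^ 5 * ((c - z\<^sup>2)\<^sup>2 * (c - 2 * z))"
          by simp
        then have "0 \<le> 2 * z * log_gap_slope c z / ((c - z\<^sup>2)\<^sup>2 * (c - 2 * z)) + 1 / 10 ^ 5"
          using pos by (simp add: field_simps)
        moreover have "DERIV ?f z :> 2 * z * log_gap_slope c z / ((c - z\<^sup>2)\<^sup>2 * (c - 2 * z)) + 1 / 10 ^ 5"
          by (intro DERIV_add DERIV_log_gap z c2) (auto intro!: derivative_eq_intros)
        ultimately show "\<exists>d. DERIV ?f z :> d \<and> 0 \<le> d" by blast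
      qed
      then show ?thesis using gap_a that by (simp add: a_def b_def)
    qed
    show ?thesis
    proof (cases "t \<le> b")
      case True
      then show ?thesis using near False by simp
    next
      case b_less: False
      have "log_gap c b \<le> log_gap c t"
      proof (rule log_gap_mono)
        fix y assume y: "b \<le> y" "y \<le> t"
        have "0 \<le> log_gap_slope c b"
          by (simp add: log_gap_slope_def c b_def power2_eq_square power3_eq_cube)
        also have "\<dots> \<le> log_gap_slope c y"
          using y t by (intro slope_mono) (auto simp: a_def b_def c)
        finally show "0 \<le> log_gap_slope c y" .
      qed (use b_less t c2 in \<open>auto simp: b_def\<close>)
      then show ?thesis using near[of b] by (simp add: a_def b_def)
    qed
  qed
qed

text \<open>Completing the square turns the claim into w + exp (- w) \<ge> (1 + S) / 2 with S^2 = 1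
  + c w^2. Writing S = 1 + w t parametrises this hyperbola rationally, with w = 2 t / (c - t^2);
  taking logarithms leaves \<open>log_gap_nonneg\<close>.\<close>

lemma clique_ratio_ge:
  assumes "0 < w"
  shows "0.94080071 \<le> clique_ratio w"
proof -
  define c :: real where "c = 1.88160142"
  define S where "S = sqrt (1 + c * w\<^sup>2)"
  define t where "t = (S - 1) / w"
  have "0 < c * w\<^sup>2" using assms by (simp add: c_def)
  then have S2: "S\<^sup>2 = 1 + c * w\<^sup>2" and S: "1 < S" by (simp_all add: S_def)
  have t: "0 < t" using S assms by (simp add: t_def)
  have wt: "w * t = S - 1" using assms by (simp add: t_def)
  have "w * (w * (c - t\<^sup>2)) = c * w\<^sup>2 - (w * t)\<^sup>2" by (simp add: power2_eq_square algebra_simps)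
  also have "\<dots> = 2 * (w * t)" unfolding wt using S2 by (simp add: power2_eq_square algebra_simps)
  finally have w_eq: "w * (c - t\<^sup>2) = 2 * t" using assms by (simp add: mult.left_commute)
  then have pos: "0 < c - t\<^sup>2" using t assms by (metis mult_pos_pos zero_less_mult_pos zero_less_numeral)
  have "(c - 2 * t) / (c - t\<^sup>2) \<le> exp (- w)"
  proof (cases "2 * t < c")
    case False
    then have "(c - 2 * t) / (c - t\<^sup>2) \<le> 0" using pos by (simp add: divide_le_0_iff)
    then show ?thesis by (meson exp_ge_zero order_trans)
  next
    case True
    have "2 * t / (c - t\<^sup>2) = w" using w_eq pos by (simp add: field_simps)
    then have "ln ((c - 2 * t) / (c - t\<^sup>2)) \<le> - w"
      using log_gap_nonneg[OF c_def _ True] t True pos by (simp add: log_gap_def ln_div)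
    moreover have "0 < (c - 2 * t) / (c - t\<^sup>2)" using True pos by simp
    ultimately show ?thesis by (metis exp_le_cancel_iff exp_ln)
  qed
  moreover have "(c - 2 * t) / (c - t\<^sup>2) = (1 + S) / 2 - w"
  proof -
    have "(1 + S) / 2 - w = 1 + w * t / 2 - w" unfolding wt by (simp add: field_simps)
    then have "((1 + S) / 2 - w) * (c - t\<^sup>2) = (1 + w * t / 2 - w) * (c - t\<^sup>2)" by simp
    also have "\<dots> = c - t\<^sup>2 + (t / 2 - 1) * (w * (c - t\<^sup>2))" by (simp add: field_simps)
    also have "\<dots> = c - 2 * t" unfolding w_eq by (simp add: algebra_simps power2_eq_square)
    finally show ?thesis using pos by (simp add: field_simps)
  qed
  ultimately have p: "(1 + S) / 2 \<le> w + exp (- w)" by linarith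
  have "c * w\<^sup>2 = 2 * ((1 + S) * ((1 + S) / 2 - 1))" using S2 by (simp add: power2_eq_square algebra_simps)
  also have "\<dots> \<le> 2 * ((2 * (w + exp (- w))) * (w + exp (- w) - 1))"
    using p S by (intro mult_mono) auto
  finally have "c / 2 * w\<^sup>2 \<le> 2 * (w + exp (- w)) * (w + exp (- w) - 1)" by (simp add: algebra_simps)
  then show ?thesis using assms by (simp add: clique_ratio_def c_def pos_le_divide_eq)
qed

section \<open>Upper bound for the minimum and its attainment\<close>

lemma clique_ratio_small: "clique_ratio 0.4064 \<le> 0.94080089"
proof -
  \<comment> \<open>With nine terms the remainder carries an odd power of a negative number, so the
    partial sum is an upper bound.\<close>
  let ?T = "\<Sum>m<9. (- 0.4064 :: real) ^ m / fact m"
  obtain z :: real where "exp (- 0.4064) = ?T + exp z / fact 9 * (- 0.4064) ^ 9"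
    using Maclaurin_exp_le[of "- 0.4064" 9] by blast
  then have "exp (- 0.4064) \<le> ?T" by simp
  moreover have "?T \<le> 0.666043698" by (simp add: eval_nat_numeral)
  ultimately have "exp (- 0.4064) \<le> (0.666043698 :: real)" by linarith
  moreover have "1 - 0.4064 \<le> exp (- 0.4064 :: real)" using exp_ge_add_one_self[of "- 0.4064 :: real"] by simp
  ultimately have "2 * (0.4064 + exp (- 0.4064)) * (0.4064 + exp (- 0.4064) - 1)
      \<le> 2 * (0.4064 + 0.666043698) * (0.4064 + 0.666043698 - 1 :: real)"
    by (intro mult_mono) auto
  also have "\<dots> \<le> 0.94080089 * 0.4064\<^sup>2" by (simp add: power2_eq_square)
  finally show ?thesis
    unfolding clique_ratio_def by (subst pos_divide_le_eq) simp_all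
qed

text \<open>Compactness gives a minimum on [0.15, 2], which is at most 0.95 by the value at 0.4064.
  Below 0.15 the ratio is at least 1 - v / 3 > 0.95, and above 2 it is at least 1.\<close>

lemma clique_ratio_attains_min:
  obtains w where "0 < w" "\<And>v. 0 < v \<Longrightarrow> clique_ratio w \<le> clique_ratio v"
proof -
  have "\<exists>w\<in>{0.15..2}. \<forall>v\<in>{0.15..2}. clique_ratio w \<le> clique_ratio v"
    unfolding clique_ratio_def
    by (rule continuous_attains_inf) (auto intro!: continuous_intros)
  then obtain w where w: "w \<in> {0.15..2}" "\<And>v. v \<in> {0.15..2} \<Longrightarrow> clique_ratio w \<le> clique_ratio v"
    by blast
  have small: "clique_ratio w \<le> 0.95"
    using w(2)[of "0.4064"] clique_ratio_small by simp
  have "clique_ratio w \<le> clique_ratio v" if "0 < v" for v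
  proof -
    consider "v < 0.15" | "v \<in> {0.15..2}" | "2 < v" by fastforce
    then show ?thesis
    proof cases
      case 1
      obtain z :: real where "exp (- v) = (\<Sum>m<4. (- v) ^ m / fact m) + exp z / fact 4 * (- v) ^ 4"
        using Maclaurin_exp_le[of "- v" 4] by blast
      then have "(\<Sum>m<4. (- v) ^ m / fact m) \<le> exp (- v)" by simp
      then have taylor: "1 - v + v\<^sup>2 / 2 - v ^ 3 / 6 \<le> exp (- v)"
        by (simp add: eval_nat_numeral)
      have "v\<^sup>2 * (1 - v / 3) = 2 * 1 * (v\<^sup>2 / 2 - v ^ 3 / 6)" by (simp add: algebra_simps power2_eq_square power3_eq_cube)
      also have "\<dots> \<le> 2 * (v + exp (- v)) * (v + exp (- v) - 1)"
      proof (rule mult_mono)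
        have "v * v\<^sup>2 \<le> 3 * v\<^sup>2" using 1 by (intro mult_right_mono) auto
        then show "0 \<le> v\<^sup>2 / 2 - v ^ 3 / 6" by (simp add: power2_eq_square power3_eq_cube)
        show "2 * 1 \<le> 2 * (v + exp (- v))" using exp_ge_add_one_self[of "- v"] by simp
        then show "0 \<le> 2 * (v + exp (- v))" by simp
        show "v\<^sup>2 / 2 - v ^ 3 / 6 \<le> v + exp (- v) - 1" using taylor by simp
      qed
      finally have "1 - v / 3 \<le> clique_ratio v"
        using that by (simp add: clique_ratio_def pos_le_divide_eq mult.commute)
      then show ?thesis using small 1 by simp
    next
      case 3
      have "v\<^sup>2 \<le> 2 * v * (v - 1)" using 3 mult_right_mono[of 2 v v] by (simp add: power2_eq_square algebra_simps)
      also have "\<dots> \<le> 2 * (v + exp (- v)) * (v + exp (- v) - 1)"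
        using 3 by (intro mult_mono) auto
      finally have "1 \<le> clique_ratio v"
        using that by (simp add: clique_ratio_def pos_le_divide_eq)
      then show ?thesis using small by simp
    qed (rule w(2))
  qed
  then show thesis using that[of w] w(1) by simp
qed

lemma PC_alpha_minimum:
  obtains w where "0 < w" "PC_alpha = clique_ratio w" "\<And>v. 0 < v \<Longrightarrow> PC_alpha \<le> clique_ratio v"
proof -
  obtain w where w: "0 < w" "\<And>v. 0 < v \<Longrightarrow> clique_ratio w \<le> clique_ratio v"
    using clique_ratio_attains_min by blast
  have "PC_alpha = clique_ratio w"
    unfolding PC_alpha_def PC_f_image by (rule Least_equality) (use w in auto)
  then show thesis using that w by simp
qed

subsection \<open>The bound on PC_beta\<close>

lemma PC_beta_upper_bound:
  assumes "simple_graph V E" "V \<noteq> {}" and "0 \<le> \<alpha>" "\<alpha> \<le> 1"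
    and ratio: "\<And>w. 0 < w \<Longrightarrow> \<alpha> \<le> clique_ratio w"
  shows "PC_beta V E \<le> real (card V) - \<alpha> * real (card E) / real (card V)"
proof -
  have fin: "finite V" and sub: "E \<subseteq> [V]\<^bsup>2\<^esup>" using assms(1) by (auto simp: simple_graph_def)
  have edges: "card e = 2" if "e \<in> E" for e using that sub by (auto simp: nsets_def)
  have "E \<inter> Pow V = E" using sub by (auto simp: nsets_def)
  define n k where "n = real (card V)" and "k = real (card E)"
  have n: "0 < n" using fin assms(2) by (simp add: n_def card_gt_0_iff)
  have "card E \<le> card V choose 2"
    using card_mono[OF finite_imp_finite_nsets[OF fin] sub] by simp
  then have "2 * card E \<le> card V * (card V - 1)" by (simp add: choose_two)
  also have "\<dots> \<le> card V * card V" by simp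
  finally have "real (2 * card E) \<le> real (card V * card V)" by (simp only: of_nat_le_iff)
  then have k: "0 \<le> k" "2 * k \<le> n * n" by (simp_all add: n_def k_def)
  obtain r where r: "0 < r" "r \<le> 1" "clique_sum V E r = 0"
    "\<And>H. H \<subseteq> V \<Longrightarrow> 0 \<le> clique_sum H E r"
    "\<And>y. 0 < y \<Longrightarrow> y < r \<Longrightarrow> clique_sum V E y \<noteq> 0"
    using least_root[OF fin assms(2)] by blast
  have "1 / r \<le> n - \<alpha> * k / n"
  proof (cases "r * n \<le> 2")
    case False
    then have "1 / r \<le> n / 2" using r(1) by (simp add: field_simps)
    moreover have "\<alpha> * k \<le> 1 * k" using assms(4) k(1) by (rule mult_right_mono)
    then have "\<alpha> * k \<le> n / 2 * n" using k(2) by simp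
    then have "\<alpha> * k / n \<le> n / 2" using n by (simp add: pos_divide_le_eq)
    ultimately show ?thesis by simp
  next
    case True
    define s where "s = sqrt (2 * k)"
    define y where "y = s * r"
    define p where "p = y + exp (- y)"
    \<comment> \<open>At the root r the clique sum vanishes, so the lower bound becomes p \<le> n
      r.\<close>
    have "exp (- (s * r)) + s * r - real (card V) * r \<le> clique_sum V E r"
      by (rule clique_sum_lower[OF edges r(1,2) fin])
        (use True r(4) in \<open>simp_all add: s_def k_def n_def \<open>E \<inter> Pow V = E\<close>\<close>)
    then have p: "p \<le> n * r" using r(3) by (simp add: p_def y_def n_def)
    have "1 \<le> p" using exp_ge_add_one_self[of "- y"] by (simp add: p_def)
    have y: "0 \<le> y" "y\<^sup>2 = 2 * k * r\<^sup>2"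
      using k(1) r(1) by (simp_all add: y_def s_def power_mult_distrib)
    have "\<alpha> * y\<^sup>2 \<le> 2 * (p * (p - 1))"
    proof (cases "y = 0")
      case True
      then show ?thesis using \<open>1 \<le> p\<close> by simp
    next
      case False
      then have "0 < y" using y(1) by simp
      then have "\<alpha> * y\<^sup>2 \<le> 2 * (y + exp (- y)) * (y + exp (- y) - 1)"
        using ratio[OF \<open>0 < y\<close>] by (simp add: clique_ratio_def pos_le_divide_eq)
      then show ?thesis by (simp only: p_def mult.assoc)
    qed
    \<comment> \<open>The function p (p - 1) increases for p \<ge> 1, so p may be replaced by n r;
      dividing by n r^2 then isolates 1 / r.\<close>
    then have "\<alpha> * k * r\<^sup>2 \<le> p * (p - 1)" by (simp add: y(2))
    also have "\<dots> \<le> (n * r) * (n * r - 1)"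
      using p \<open>1 \<le> p\<close> by (intro mult_mono) auto
    also have "\<dots> = n * (n - 1 / r) * r\<^sup>2" using r(1) by (simp add: power2_eq_square field_simps)
    finally have "\<alpha> * k \<le> n * (n - 1 / r)" using r(1) by simp
    then have "\<alpha> * k / n \<le> n - 1 / r" using n by (simp add: pos_divide_le_eq mult.commute)
    then show ?thesis by simp
  qed
  moreover have "PC_beta V E = 1 / r"
    by (rule PC_beta_eq_inverse_root[OF fin r(1,3)]) (rule r(5))
  ultimately show ?thesis by (simp add: n_def k_def)
qed

theorem theorem8p2:
  shows "(\<exists>t>1. PC_f t = PC_alpha) \<and> (\<forall>t>1. PC_alpha \<le> PC_f t) \<and> \<bar>PC_alpha - 0.9408008\<bar> < 1 / 10 ^ 7 \<and>
    (\<exists>N. \<forall>n\<ge>N. \<forall>(V :: 'a set) E. simple_graph V E \<and> card V = n \<longrightarrow>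
       PC_beta V E \<le> real n - PC_alpha * real (card E) / real n \<and>
       edge_PC_density V E \<ge> PC_alpha / real n)"
proof -
  obtain w where w: "0 < w" "PC_alpha = clique_ratio w"
    and min: "\<And>v. 0 < v \<Longrightarrow> PC_alpha \<le> clique_ratio v"
    using PC_alpha_minimum by blast
  have lower: "0.94080071 \<le> PC_alpha" using clique_ratio_ge[OF w(1)] w(2) by simp
  have upper: "PC_alpha \<le> 0.94080089" using min[of "0.4064"] clique_ratio_small by simp
  have "PC_alpha \<in> PC_f ` {1<..}" unfolding PC_f_image using w by blast
  then have attained: "\<exists>t>1. PC_f t = PC_alpha" by auto
  have minimal: "\<forall>t>1. PC_alpha \<le> PC_f t"
  proof (intro allI impI)
    fix t :: real assume "1 < t"
    then have "PC_f t \<in> clique_ratio ` {0<..}" unfolding PC_f_image[symmetric] by simp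
    then show "PC_alpha \<le> PC_f t" using min by auto
  qed
  have bounds: "PC_beta V E \<le> real n - PC_alpha * real (card E) / real n \<and>
      PC_alpha / real n \<le> edge_PC_density V E"
    if "1 \<le> n" "simple_graph V E" "card V = n" for n and V :: "'a set" and E
  proof -
    have "V \<noteq> {}" using that by auto
    then have beta: "PC_beta V E \<le> real n - PC_alpha * real (card E) / real n"
      using PC_beta_upper_bound[OF that(2) _ _ _ min] lower upper that(3) by auto
    have "PC_alpha / real n \<le> edge_PC_density V E"
    proof (cases "E = {}")
      \<comment> \<open>Without edges the density is 1 / n by convention, and the claim is
        \<open>PC_alpha\<close> \<le> 1.\<close>
      case True
      then show ?thesis using upper that by (simp add: edge_PC_density_def divide_right_mono)
    next
      case False
      have "finite E"
        using that(2) finite_subset finite_imp_finite_nsets by (auto simp: simple_graph_def)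
      then have "0 < real (card E)" using False by (simp add: card_gt_0_iff)
      then show ?thesis
        using False beta that(3) by (simp add: edge_PC_density_def pos_le_divide_eq)
    qed
    with beta show ?thesis by blast
  qed
  have "\<exists>N. \<forall>n\<ge>N. \<forall>(V :: 'a set) E. simple_graph V E \<and> card V = n \<longrightarrow>
       PC_beta V E \<le> real n - PC_alpha * real (card E) / real n \<and>
       edge_PC_density V E \<ge> PC_alpha / real n"
    \<comment> \<open>The threshold is 1: the bounds hold for every graph with a vertex.\<close>
    using bounds by (intro exI[of _ 1]) blast
  moreover have "\<bar>PC_alpha - 0.9408008\<bar> < 1 / 10 ^ 7" using lower upper by (simp add: abs_if)
  ultimately show ?thesis using attained minimal by blast
qed

end
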